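(* Let $d\ge 1$ be fixed and let $\Sigma$ be a finite alphabet. For every $\varepsilon$ with $0<\varepsilon<1/2$ there exist $N,T\in\mathbb{N}$ such that for every $d$-dimensional matrix $A$ of order $n\ge N$ over $\Sigma$ there exists an $\varepsilon$-regular (balanced) block partition $\mathcal{B}$ of $A$ whose cardinality satisfies $|\mathcal{B}|\le T$.
   Context: A $d$-dimensional matrix $A$ of sizes $n^1\times\cdots\times n^d$ over an alphabet $\Sigma$ is an array $(a_\alpha)$ indexed by $\alpha=(\alpha_1,\dots,\alpha_d)$, $\alpha_i\in\{1,\dots,n^i\}$, with $a_\alpha\in\Sigma$; it has order $n$ if all $n^i=n$. A block of $A$ of sizes $m^1\times\cdots\times m^d$ is a submatrix of $A$ with these sizes (obtained by choosing $m^i$ indices in the $i$-th coordinate for each $i$). For a matrix or block $A$: the volume $|A|$ is its number of entries $\prod_i n^i$, the weight $w_\sigma(A)$ is the number of entries equal to $\sigma$, and the density is $\rho_\sigma(A)=w_\sigma(A)/|A|$. Given $\varepsilon>0$, a matrix $A$ of sizes $n^1\times\cdots\times n^d$ is $\varepsilon$-regular if for every $\sigma\in\Sigma$ and every block $B$ of $A$ of sizes $m^1\times\cdots\times m^d$ with $m^i\ge\varepsilon n^i$ for all $i$, $|\rho_\sigma(B)-\rho_\sigma(A)|\le\varepsilon$; otherwise it is $\varepsilon$-irregular. A block partition of $A$ is a system of pairwise disjoint blocks $\{B_\beta\}$, $\beta=(\beta_1,\dots,\beta_d)$ with $\beta_i\in\{1,\dots,t^i\}$, where $B_\beta$ has sizes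 $m^1_{\beta_1}\times\cdots\times m^d_{\beta_d}$, whose union is $A$. Each block partition comes with a division of its blocks into ordinary blocks (whose union forms a submatrix of $A$) and exceptional blocks. The cardinality $|\mathcal{B}|$ is the number of ordinary blocks. A block partition is balanced of order $t$ if all ordinary blocks have the same order $m$ and the union of the ordinary blocks is a matrix of order $tm$. A balanced block partition $\mathcal{B}$ is $\varepsilon$-regular if the sum of volumes of all exceptional blocks is at most $\varepsilon|A|$ and all ordinary blocks except at most $\varepsilon|\mathcal{B}|$ of them are $\varepsilon$-regular. *)

theory Defs
  imports Complex_Main "HOL-Library.FuncSet" "HOL-Library.Disjoint_Sets"
begin

text \<open>
  A \<open>d\<close>-dimensional matrix is a function on multi-indices, which are extensional functions on
  \<open>{1..d}\<close>. A block of a matrix \<open>A\<close> is given by the choice of an index set \<open>S i\<close> in every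
  coordinate \<open>i \<in> {1..d}\<close>; its entries are \<open>A \<alpha>\<close> for \<open>\<alpha> \<in> cells d S\<close> and its sizes are
  \<open>card (S i)\<close>. Values of \<open>S\<close> outside \<open>{1..d}\<close> are irrelevant. The matrix of
  sizes \<open>n 1, \<dots>, n d\<close> is its own block \<open>full n\<close>.
\<close>

type_synonym index = "nat \<Rightarrow> nat"
type_synonym 'a matrix = "index \<Rightarrow> 'a"
type_synonym block = "nat \<Rightarrow> nat set"

definition cells :: "nat \<Rightarrow> block \<Rightarrow> index set" where
  "cells d S = (\<Pi>\<^sub>E i\<in>{1..d}. S i)"

definition full :: "(nat \<Rightarrow> nat) \<Rightarrow> block" where
  "full n = (\<lambda>i. {1..n i})"

definition matrix_over :: "nat \<Rightarrow> 'a set \<Rightarrow> (nat \<Rightarrow> nat) \<Rightarrow> 'a matrix \<Rightarrow> bool" where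
  "matrix_over d \<Sigma> n A \<longleftrightarrow> (\<forall>\<alpha>\<in>cells d (full n). A \<alpha> \<in> \<Sigma>)"

definition block_of :: "nat \<Rightarrow> block \<Rightarrow> block \<Rightarrow> bool" where
  "block_of d S B \<longleftrightarrow> (\<forall>i\<in>{1..d}. B i \<subseteq> S i)"

definition block_volume :: "nat \<Rightarrow> block \<Rightarrow> nat" where
  "block_volume d S = card (cells d S)"

definition block_weight :: "nat \<Rightarrow> 'a matrix \<Rightarrow> 'a \<Rightarrow> block \<Rightarrow> nat" where
  "block_weight d A \<sigma> S = card {\<alpha> \<in> cells d S. A \<alpha> = \<sigma>}"

definition block_density :: "nat \<Rightarrow> 'a matrix \<Rightarrow> 'a \<Rightarrow> block \<Rightarrow> real" where
  "block_density d A \<sigma> S = real (block_weight d A \<sigma> S) / real (block_volume d S)"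

definition regular_block :: "nat \<Rightarrow> 'a set \<Rightarrow> real \<Rightarrow> 'a matrix \<Rightarrow> block \<Rightarrow> bool" where
  "regular_block d \<Sigma> \<epsilon> A S \<longleftrightarrow>
     (\<forall>\<sigma>\<in>\<Sigma>. \<forall>B. block_of d S B \<and> (\<forall>i\<in>{1..d}. real (card (B i)) \<ge> \<epsilon> * real (card (S i))) \<longrightarrow>
        \<bar>block_density d A \<sigma> B - block_density d A \<sigma> S\<bar> \<le> \<epsilon>)"

text \<open>
  A block partition of \<open>S\<close> is a grid of nonempty blocks \<open>\<B> \<beta>\<close>, \<open>\<beta> \<in> cells d (full s)\<close>: the \<open>i\<close>-th
  index set of \<open>\<B> \<beta>\<close> is some \<open>P i (\<beta> i)\<close>, so that the sizes of \<open>\<B> \<beta>\<close> are the numbers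
  \<open>m i (\<beta> i) = card (P i (\<beta> i))\<close>. The division into ordinary and exceptional blocks is given by the
  set \<open>R\<close> of those \<open>\<beta>\<close> for which \<open>\<B> \<beta>\<close> is ordinary. Since the blocks are nonempty and disjoint,
  \<open>\<B>\<close> is injective and \<open>card R\<close> is the number of ordinary blocks.
\<close>

definition block_partition ::
    "nat \<Rightarrow> block \<Rightarrow> (nat \<Rightarrow> nat) \<Rightarrow> (index \<Rightarrow> block) \<Rightarrow> index set \<Rightarrow> bool" where
  "block_partition d S s \<B> R \<longleftrightarrow>
     (\<forall>\<beta>\<in>cells d (full s). block_of d S (\<B> \<beta>) \<and> cells d (\<B> \<beta>) \<noteq> {}) \<and>
     (\<exists>P. \<forall>\<beta>\<in>cells d (full s). \<forall>i\<in>{1..d}. \<B> \<beta> i = P i (\<beta> i)) \<and>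
     disjoint_family_on (\<lambda>\<beta>. cells d (\<B> \<beta>)) (cells d (full s)) \<and>
     (\<Union>\<beta>\<in>cells d (full s). cells d (\<B> \<beta>)) = cells d S \<and>
     R \<subseteq> cells d (full s) \<and>
     (\<exists>U. block_of d S U \<and> (\<Union>\<beta>\<in>R. cells d (\<B> \<beta>)) = cells d U)"

definition partition_card :: "index set \<Rightarrow> nat" where
  "partition_card R = card R"

definition balanced_partition ::
    "nat \<Rightarrow> block \<Rightarrow> (nat \<Rightarrow> nat) \<Rightarrow> (index \<Rightarrow> block) \<Rightarrow> index set \<Rightarrow> nat \<Rightarrow> bool" where
  "balanced_partition d S s \<B> R t \<longleftrightarrow>
     block_partition d S s \<B> R \<and>
     (\<exists>m. (\<forall>\<beta>\<in>R. \<forall>i\<in>{1..d}. card (\<B> \<beta> i) = m) \<and>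
          (\<exists>U. block_of d S U \<and> (\<forall>i\<in>{1..d}. card (U i) = t * m) \<and>
               (\<Union>\<beta>\<in>R. cells d (\<B> \<beta>)) = cells d U))"

definition regular_partition ::
    "nat \<Rightarrow> 'a set \<Rightarrow> real \<Rightarrow> 'a matrix \<Rightarrow> block \<Rightarrow> (nat \<Rightarrow> nat) \<Rightarrow> (index \<Rightarrow> block) \<Rightarrow> index set \<Rightarrow> bool"
  where
  "regular_partition d \<Sigma> \<epsilon> A S s \<B> R \<longleftrightarrow>
     (\<exists>t. balanced_partition d S s \<B> R t) \<and>
     real (\<Sum>\<beta>\<in>cells d (full s) - R. block_volume d (\<B> \<beta>)) \<le> \<epsilon> * real (block_volume d S) \<and>
     real (card {\<beta>\<in>R. \<not> regular_block d \<Sigma> \<epsilon> A (\<B> \<beta>)}) \<le> \<epsilon> * real (partition_card R)"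

end

theory Submission
  imports Defs "HOL-Analysis.Convex"
begin

text \<open>
  Energy increment. Every coordinate carries a partition of its index set, and the energy of the
  resulting grid is the sum over \<open>\<sigma>\<close> of the squared norm of the conditional expectation of the
  indicator of \<open>\<sigma>\<close>; it is at most \<open>n ^ d\<close>. If too many ordinary blocks are irregular, refining all
  coordinates by the witnesses of irregularity raises the energy by at least
  \<open>\<epsilon> ^ (d + 3) / 2 * n ^ d\<close>. The refined classes are then cut into pieces of a common, much smaller
  size, and only a small proportion of the indices is lost to the exceptional part. After boundedly
  many rounds this must stop at a regular partition.
\<close>

section \<open>Conditional averages over the fibres of a labelling\<close>

text \<open>Partitions are encoded by labelling functions: the parts are the fibres of
  \<open>F\<close> in \<open>\<Omega>\<close>, so refinement becomes an implication between
  equalities of labels.\<close>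

definition cond_avg :: "'b set \<Rightarrow> ('b \<Rightarrow> 'l) \<Rightarrow> ('b \<Rightarrow> real) \<Rightarrow> 'b \<Rightarrow> real" where
  "cond_avg \<Omega> F x \<alpha> = (\<Sum>\<beta>\<in>{\<beta>\<in>\<Omega>. F \<beta> = F \<alpha>}. x \<beta>) / real (card {\<beta>\<in>\<Omega>. F \<beta> = F \<alpha>})"

lemma cond_avg_cong: "F \<alpha> = F \<beta> \<Longrightarrow> cond_avg \<Omega> F x \<alpha> = cond_avg \<Omega> F x \<beta>"
  by (simp add: cond_avg_def)

text \<open>Conditional averaging is the orthogonal projection onto the functions that are constant
  on the fibres of \<open>F\<close>. The left side expands to a sum over pairs in a common fibre;
  summing in the other order leaves \<open>x \<beta> * h \<beta>\<close>, because \<open>h\<close>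
  is constant on the fibre.\<close>

lemma sum_cond_avg_mult:
  assumes fin: "finite \<Omega>"
    and h: "\<And>\<alpha> \<beta>. \<alpha> \<in> \<Omega> \<Longrightarrow> \<beta> \<in> \<Omega> \<Longrightarrow> F \<alpha> = F \<beta> \<Longrightarrow> h \<alpha> = h \<beta>"
  shows "(\<Sum>\<alpha>\<in>\<Omega>. cond_avg \<Omega> F x \<alpha> * h \<alpha>) = (\<Sum>\<alpha>\<in>\<Omega>. x \<alpha> * h \<alpha>)"
proof -
  define N where "N \<alpha> = real (card {\<beta>\<in>\<Omega>. F \<beta> = F \<alpha>})" for \<alpha>
  have "(\<Sum>\<alpha>\<in>\<Omega>. cond_avg \<Omega> F x \<alpha> * h \<alpha>)
      = (\<Sum>\<alpha>\<in>\<Omega>. \<Sum>\<beta>\<in>\<Omega>. if F \<beta> = F \<alpha> then x \<beta> * h \<alpha> / N \<alpha> else 0)"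
  proof (rule sum.cong[OF refl])
    fix \<alpha>
    have "cond_avg \<Omega> F x \<alpha> * h \<alpha> = (\<Sum>\<beta>\<in>{\<beta>\<in>\<Omega>. F \<beta> = F \<alpha>}. x \<beta> * h \<alpha> / N \<alpha>)"
      by (simp add: cond_avg_def N_def sum_distrib_right flip: sum_divide_distrib)
    also have "\<dots> = (\<Sum>\<beta>\<in>\<Omega>. if F \<beta> = F \<alpha> then x \<beta> * h \<alpha> / N \<alpha> else 0)"
      by (rule sum.inter_filter[OF fin])
    finally show "cond_avg \<Omega> F x \<alpha> * h \<alpha> = \<dots>" .
  qed
  also have "\<dots> = (\<Sum>\<beta>\<in>\<Omega>. \<Sum>\<alpha>\<in>\<Omega>. if F \<beta> = F \<alpha> then x \<beta> * h \<alpha> / N \<alpha> else 0)"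
    by (rule sum.swap)
  also have "\<dots> = (\<Sum>\<beta>\<in>\<Omega>. x \<beta> * h \<beta>)"
  proof (intro sum.cong refl)
    fix \<beta> assume b: "\<beta> \<in> \<Omega>"
    have "(\<Sum>\<alpha>\<in>\<Omega>. if F \<beta> = F \<alpha> then x \<beta> * h \<alpha> / N \<alpha> else 0)
        = (\<Sum>\<alpha>\<in>\<Omega>. if F \<alpha> = F \<beta> then x \<beta> * h \<beta> / N \<beta> else 0)"
    proof (rule sum.cong[OF refl])
      fix \<alpha> assume "\<alpha> \<in> \<Omega>"
      then show "(if F \<beta> = F \<alpha> then x \<beta> * h \<alpha> / N \<alpha> else 0) = (if F \<alpha> = F \<beta> then x \<beta> * h \<beta> / N \<beta> else 0)"
        using h[OF b, of \<alpha>] by (cases "F \<beta> = F \<alpha>") (simp_all add: N_def)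
    qed
    also have "\<dots> = N \<beta> * (x \<beta> * h \<beta> / N \<beta>)"
      by (subst sum.inter_filter[OF fin, symmetric]) (simp add: N_def)
    also have "\<dots> = x \<beta> * h \<beta>"
    proof -
      have "{\<gamma>\<in>\<Omega>. F \<gamma> = F \<beta>} \<noteq> {}" using b by auto
      then have "N \<beta> \<noteq> 0" using fin by (simp add: N_def)
      then show ?thesis by simp
    qed
    finally show "(\<Sum>\<alpha>\<in>\<Omega>. if F \<beta> = F \<alpha> then x \<beta> * h \<alpha> / N \<alpha> else 0) = x \<beta> * h \<beta>" .
  qed
  finally show ?thesis .
qed

text \<open>Since \<open>G\<close> refines \<open>F\<close>, the \<open>F\<close>-average is
  constant on the fibres of \<open>G\<close>. Both averages thus have the same inner product with
  it, so their difference is orthogonal to the coarser one.\<close>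

lemma sum_cond_avg_pythagoras:
  assumes fin: "finite \<Omega>"
    and ref: "\<And>\<alpha> \<beta>. \<alpha> \<in> \<Omega> \<Longrightarrow> \<beta> \<in> \<Omega> \<Longrightarrow> G \<alpha> = G \<beta> \<Longrightarrow> F \<alpha> = F \<beta>"
  shows "(\<Sum>\<alpha>\<in>\<Omega>. (cond_avg \<Omega> G x \<alpha>)\<^sup>2)
       = (\<Sum>\<alpha>\<in>\<Omega>. (cond_avg \<Omega> F x \<alpha>)\<^sup>2) + (\<Sum>\<alpha>\<in>\<Omega>. (cond_avg \<Omega> G x \<alpha> - cond_avg \<Omega> F x \<alpha>)\<^sup>2)"
proof -
  let ?f = "cond_avg \<Omega> F x" and ?g = "cond_avg \<Omega> G x"
  have "(\<Sum>\<alpha>\<in>\<Omega>. ?g \<alpha> * ?f \<alpha>) = (\<Sum>\<alpha>\<in>\<Omega>. x \<alpha> * ?f \<alpha>)"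
    by (rule sum_cond_avg_mult[OF fin]) (rule cond_avg_cong[where F = F], rule ref)
  also have "\<dots> = (\<Sum>\<alpha>\<in>\<Omega>. ?f \<alpha> * ?f \<alpha>)"
    by (rule sum_cond_avg_mult[OF fin, symmetric]) (rule cond_avg_cong)
  finally have "(\<Sum>\<alpha>\<in>\<Omega>. ?g \<alpha> * ?f \<alpha>) = (\<Sum>\<alpha>\<in>\<Omega>. (?f \<alpha>)\<^sup>2)"
    by (simp add: power2_eq_square)
  moreover have "(\<Sum>\<alpha>\<in>\<Omega>. (?g \<alpha> - ?f \<alpha>)\<^sup>2)
      = (\<Sum>\<alpha>\<in>\<Omega>. (?g \<alpha>)\<^sup>2) + (\<Sum>\<alpha>\<in>\<Omega>. (?f \<alpha>)\<^sup>2) - 2 * (\<Sum>\<alpha>\<in>\<Omega>. ?g \<alpha> * ?f \<alpha>)"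
    by (simp add: power2_diff sum.distrib sum_subtractf sum_distrib_left mult.assoc)
  ultimately show ?thesis by simp
qed

text \<open>The finest labelling \<open>id\<close> refines every \<open>F\<close>, and averaging
  over its fibres gives back \<open>x\<close>.\<close>

lemma sum_cond_avg_square_le:
  assumes fin: "finite \<Omega>"
  shows "(\<Sum>\<alpha>\<in>\<Omega>. (cond_avg \<Omega> F x \<alpha>)\<^sup>2) \<le> (\<Sum>\<alpha>\<in>\<Omega>. (x \<alpha>)\<^sup>2)"
proof -
  have "cond_avg \<Omega> id x \<alpha> = x \<alpha>" if "\<alpha> \<in> \<Omega>" for \<alpha>
  proof -
    have "{\<beta>\<in>\<Omega>. \<beta> = \<alpha>} = {\<alpha>}" using that by auto
    then show ?thesis by (simp add: cond_avg_def)
  qed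
  moreover have "(\<Sum>\<alpha>\<in>\<Omega>. (cond_avg \<Omega> id x \<alpha>)\<^sup>2) \<ge> (\<Sum>\<alpha>\<in>\<Omega>. (cond_avg \<Omega> F x \<alpha>)\<^sup>2)"
    using sum_cond_avg_pythagoras[OF fin, of id F x] by (simp add: sum_nonneg)
  ultimately show ?thesis by simp
qed

text \<open>This localises the energy gain to one cell \<open>C\<close> of the coarse partition. By
  \<open>sat\<close>, \<open>B\<close> is a union of fibres of \<open>G\<close>, so the
  \<open>G\<close>-average has the same sum over \<open>B\<close> as \<open>x\<close>, while the
  \<open>F\<close>-average is constant on \<open>C\<close>. Cauchy-Schwarz on \<open>B\<close> then
  gives the bound.\<close>

lemma sum_cond_avg_diff_ge:
  fixes x :: "'b \<Rightarrow> real"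
  assumes fin: "finite \<Omega>" and C: "C = {\<alpha>\<in>\<Omega>. F \<alpha> = c}" and B: "B \<subseteq> C"
    and sat: "\<And>\<alpha> \<beta>. \<alpha> \<in> B \<Longrightarrow> \<beta> \<in> \<Omega> \<Longrightarrow> G \<alpha> = G \<beta> \<Longrightarrow> \<beta> \<in> B"
  shows "(\<Sum>\<alpha>\<in>C. (cond_avg \<Omega> G x \<alpha> - cond_avg \<Omega> F x \<alpha>)\<^sup>2)
       \<ge> real (card B) * (sum x B / real (card B) - sum x C / real (card C))\<^sup>2"
proof (cases "B = {}")
  case True
  then show ?thesis by (simp add: sum_nonneg)
next
  case False
  let ?f = "cond_avg \<Omega> F x" and ?g = "cond_avg \<Omega> G x"
  have finC: "finite C" and BO: "B \<subseteq> \<Omega>" using C fin B by auto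
  then have finB: "finite B" using B finite_subset by blast
  have pos: "real (card B) > 0" using False finB by (simp add: card_gt_0_iff)
  have on: "(\<Sum>\<alpha>\<in>\<Omega>. y \<alpha> * of_bool (\<alpha> \<in> B)) = sum y B" for y :: "'b \<Rightarrow> real"
    using sum.mono_neutral_cong_right[OF fin BO, of "\<lambda>\<alpha>. y \<alpha> * of_bool (\<alpha> \<in> B)" y] by simp
  have "sum ?g B = sum x B"
  proof -
    have "(of_bool (\<alpha> \<in> B) :: real) = of_bool (\<beta> \<in> B)"
      if "\<alpha> \<in> \<Omega>" "\<beta> \<in> \<Omega>" "G \<alpha> = G \<beta>" for \<alpha> \<beta>
      using sat[of \<alpha> \<beta>] sat[of \<beta> \<alpha>] that by auto
    from sum_cond_avg_mult[where F = G and x = x and h = "\<lambda>\<alpha>. of_bool (\<alpha> \<in> B)", OF fin this] show ?thesis unfolding on .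
  qed
  moreover have "?f \<alpha> = sum x C / real (card C)" if "\<alpha> \<in> B" for \<alpha>
    using that B C by (auto simp: cond_avg_def)
  ultimately have "(\<Sum>\<alpha>\<in>B. ?g \<alpha> - ?f \<alpha>) = sum x B - real (card B) * (sum x C / real (card C))"
    by (simp add: sum_subtractf)
  also have "\<dots> = real (card B) * (sum x B / real (card B) - sum x C / real (card C))"
    using pos by (simp add: field_simps)
  finally have eq: "(\<Sum>\<alpha>\<in>B. ?g \<alpha> - ?f \<alpha>) = \<dots>" .
  have "(\<Sum>\<alpha>\<in>B. ?g \<alpha> - ?f \<alpha>)\<^sup>2 \<le> (\<Sum>\<alpha>\<in>B. (?g \<alpha> - ?f \<alpha>)\<^sup>2) * real (card B)"
    by (rule sum_squared_le_sum_of_squares)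
  also have "\<dots> \<le> (\<Sum>\<alpha>\<in>C. (?g \<alpha> - ?f \<alpha>)\<^sup>2) * real (card B)"
    by (intro mult_right_mono sum_mono2 finC B) auto
  finally show ?thesis
    using pos unfolding eq by (simp add: power2_eq_square mult_ac)
qed

section \<open>Cutting a set into pieces of equal size\<close>

text \<open>Greedy cutting: as long as a piece is missing, at least \<open>m + L * m\<close>
  elements are left over, and they carry at most \<open>L\<close> labels, so some label occurs
  \<open>m\<close> times among them. The value \<open>k\<close> of \<open>h\<close> marks the final
  leftover.\<close>

lemma chop_into_equal_pieces:
  fixes g :: "'v \<Rightarrow> 'l"
  assumes fin: "finite P" and L: "card (g ` P) \<le> L"
  shows "k * m + L * m \<le> card P \<Longrightarrow>
    \<exists>h. (\<forall>l<k. card {v\<in>P. h v = l} = m) \<and> (\<forall>v\<in>P. h v \<le> k) \<and>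
        (\<forall>u\<in>P. \<forall>v\<in>P. h u = h v \<longrightarrow> h u < k \<longrightarrow> g u = g v)"
proof (induction k)
  case 0
  show ?case by (rule exI[of _ "\<lambda>_. 0"]) auto
next
  case (Suc k)
  then obtain h where h: "\<forall>l<k. card {v\<in>P. h v = l} = m" "\<forall>v\<in>P. h v \<le> k"
      "\<forall>u\<in>P. \<forall>v\<in>P. h u = h v \<longrightarrow> h u < k \<longrightarrow> g u = g v"
    by (auto simp: algebra_simps)
  define X where "X = {v\<in>P. h v = k}"
  have finX: "finite X" using fin by (simp add: X_def)
  have "card P = card X + (\<Sum>l<k. card {v\<in>P. h v = l})"
  proof -
    have "P = X \<union> (\<Union>l<k. {v\<in>P. h v = l})" using h(2) by (auto simp: X_def order_le_less)
    then have "card P = card (X \<union> (\<Union>l<k. {v\<in>P. h v = l}))" by simp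
    also have "\<dots> = card X + card (\<Union>l<k. {v\<in>P. h v = l})"
      by (rule card_Un_disjoint) (use fin finX in \<open>auto simp: X_def\<close>)
    also have "card (\<Union>l<k. {v\<in>P. h v = l}) = (\<Sum>l<k. card {v\<in>P. h v = l})"
      by (rule card_UN_disjoint) (use fin in auto)
    finally show ?thesis .
  qed
  then have cX: "card X \<ge> m + L * m" using h(1) Suc.prems by simp
  obtain c where c: "m \<le> card {v\<in>X. g v = c}"
  proof (rule ccontr)
    assume "\<not> thesis"
    with that have less: "card {v\<in>X. g v = c} < m" for c by (meson not_le)
    have "X = (\<Union>c\<in>g ` X. {v\<in>X. g v = c})" by auto
    then have "card X \<le> (\<Sum>c\<in>g ` X. card {v\<in>X. g v = c})"
      using card_UN_le[of "g ` X" "\<lambda>c. {v\<in>X. g v = c}"] finX by simp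
    also have "\<dots> \<le> card (g ` X) * m"
      using sum_bounded_above[of "g ` X" "\<lambda>c. card {v\<in>X. g v = c}" m] less
      by (simp add: less_imp_le)
    also have "\<dots> \<le> L * m"
      by (intro mult_right_mono order_trans[OF card_mono L]) (use fin in \<open>auto simp: X_def\<close>)
    \<comment> \<open>The bound \<open>card X \<le> L * m\<close> contradicts \<open>cX\<close> only
      for positive \<open>m\<close>; the instance at an arbitrary label supplies that.\<close>
    finally show False using cX less[of undefined] by simp
  qed
  then obtain Y where Y: "Y \<subseteq> {v\<in>X. g v = c}" "card Y = m"
    using obtain_subset_with_card_n by metis
  \<comment> \<open>\<open>Y\<close> keeps the label \<open>k\<close> and becomes the new piece; the
    rest of the leftover moves on to \<open>Suc k\<close>.\<close>
  define h' where "h' v = (if h v = k \<and> v \<notin> Y then Suc k else h v)" for v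
  show ?case
  proof (intro exI[of _ h'] conjI allI impI ballI)
    fix l assume "l < Suc k"
    then consider "l < k" | "l = k" by linarith
    then show "card {v\<in>P. h' v = l} = m"
    proof cases
      case 1
      then have "{v\<in>P. h' v = l} = {v\<in>P. h v = l}" by (auto simp: h'_def)
      then show ?thesis using h(1) 1 by simp
    next
      case 2
      then have "{v\<in>P. h' v = l} = Y" using Y(1) by (auto simp: h'_def X_def)
      then show ?thesis using Y(2) by simp
    qed
  next
    fix v assume "v \<in> P"
    then show "h' v \<le> Suc k" using h(2) by (auto simp: h'_def le_SucI)
  next
    fix u v assume uv: "u \<in> P" "v \<in> P" "h' u = h' v" "h' u < Suc k"
    show "g u = g v"
    proof (cases "h' u = k")
      case True
      then have "u \<in> Y" "v \<in> Y" using uv by (auto simp: h'_def split: if_splits)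
      then show ?thesis using Y(1) by auto
    next
      case False
      then have "h u = h v" "h u < k" using uv by (auto simp: h'_def split: if_splits)
      then show ?thesis using h(3) uv by blast
    qed
  qed
qed

section \<open>Labellings of the coordinates and the energy of their grid\<close>

text \<open>Labels \<open>1, \<dots>, t\<close> name the ordinary parts in each coordinate. Every other index gets a label
  of its own, so that exceptional indices count as singleton parts and the energy stays monotone
  under refinement.\<close>

definition equitable :: "nat \<Rightarrow> nat \<Rightarrow> nat \<Rightarrow> nat \<Rightarrow> (nat \<Rightarrow> nat \<Rightarrow> nat) \<Rightarrow> bool" where
  "equitable d n t m f \<longleftrightarrow> (\<forall>i\<in>{1..d}.
     (\<forall>j\<in>{1..t}. card {v\<in>{1..n}. f i v = j} = m) \<and>
     (\<forall>v\<in>{1..n}. f i v \<in> {1..t} \<or> f i v = t + v))"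

definition part :: "nat \<Rightarrow> (nat \<Rightarrow> nat \<Rightarrow> nat) \<Rightarrow> index \<Rightarrow> block" where
  "part n f \<beta> = (\<lambda>i. {v\<in>{1..n}. f i v = \<beta> i})"

definition grid :: "nat \<Rightarrow> (nat \<Rightarrow> nat \<Rightarrow> nat) \<Rightarrow> index \<Rightarrow> index" where
  "grid d f \<alpha> = (\<lambda>i\<in>{1..d}. f i (\<alpha> i))"

definition irregular :: "nat \<Rightarrow> 'a set \<Rightarrow> real \<Rightarrow> 'a matrix \<Rightarrow> nat \<Rightarrow> nat \<Rightarrow> (nat \<Rightarrow> nat \<Rightarrow> nat) \<Rightarrow> index set"
  where "irregular d \<Sigma> \<epsilon> A n t f =
    {\<beta>\<in>cells d (full (\<lambda>_. t)). \<not> regular_block d \<Sigma> \<epsilon> A (part n f \<beta>)}"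

definition energy :: "nat \<Rightarrow> 'a set \<Rightarrow> 'a matrix \<Rightarrow> nat \<Rightarrow> (nat \<Rightarrow> nat \<Rightarrow> nat) \<Rightarrow> real" where
  "energy d \<Sigma> A n f = (\<Sum>\<sigma>\<in>\<Sigma>. \<Sum>\<alpha>\<in>cells d (full (\<lambda>_. n)).
     (cond_avg (cells d (full (\<lambda>_. n))) (grid d f) (\<lambda>\<alpha>. of_bool (A \<alpha> = \<sigma>)) \<alpha>)\<^sup>2)"

lemma finite_cells: "(\<And>i. i \<in> {1..d} \<Longrightarrow> finite (S i)) \<Longrightarrow> finite (cells d S)"
  unfolding cells_def by (rule finite_PiE) auto

lemma card_cells: "card (cells d S) = (\<Prod>i\<in>{1..d}. card (S i))"
  unfolding cells_def by (rule card_PiE) simp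

lemma card_cells_const: "(\<And>i. i \<in> {1..d} \<Longrightarrow> card (S i) = m) \<Longrightarrow> card (cells d S) = m ^ d"
  by (simp add: card_cells)

lemma finite_cells_full [simp]: "finite (cells d (full s))"
  by (rule finite_cells) (simp add: full_def)

lemma card_cells_full [simp]: "card (cells d (full (\<lambda>_. n))) = n ^ d"
  by (rule card_cells_const) (simp add: full_def)

text \<open>Blocks of the grid are fibres of \<open>grid d f\<close>, which ties block densities to
  conditional averages. As \<open>grid\<close> only takes extensional values, \<open>\<beta>\<close>
  has to be extensional as well.\<close>

lemma cells_part:
  assumes "\<beta> \<in> extensional {1..d}"
  shows "cells d (part n f \<beta>) = {\<alpha>\<in>cells d (full (\<lambda>_. n)). grid d f \<alpha> = \<beta>}"
proof -
  have "grid d f \<alpha> = \<beta> \<longleftrightarrow> (\<forall>i\<in>{1..d}. f i (\<alpha> i) = \<beta> i)" for \<alpha>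
  proof -
    have "grid d f \<alpha> \<in> extensional {1..d}" by (simp add: grid_def)
    with assms show ?thesis
      by (auto simp: grid_def fun_eq_iff extensional_def)
  qed
  then show ?thesis by (auto simp: cells_def part_def full_def PiE_iff extensional_def)
qed

lemma sum_of_bool_cells:
  assumes "finite (cells d S)"
  shows "(\<Sum>\<alpha>\<in>cells d S. of_bool (A \<alpha> = \<sigma>) :: real) / real (card (cells d S)) = block_density d A \<sigma> S"
  using assms by (simp add: block_density_def block_weight_def block_volume_def Int_def)

text \<open>Averaging does not increase the sum of squares, and each entry of the matrix equals at
  most one letter of \<open>\<Sigma>\<close>.\<close>

lemma energy_le:
  assumes "finite \<Sigma>"
  shows "energy d \<Sigma> A n f \<le> real n ^ d"
proof -
  let ?\<Omega> = "cells d (full (\<lambda>_. n))"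
  have "energy d \<Sigma> A n f \<le> (\<Sum>\<sigma>\<in>\<Sigma>. \<Sum>\<alpha>\<in>?\<Omega>. (of_bool (A \<alpha> = \<sigma>))\<^sup>2)"
    unfolding energy_def by (intro sum_mono sum_cond_avg_square_le) simp
  also have "\<dots> = (\<Sum>\<alpha>\<in>?\<Omega>. \<Sum>\<sigma>\<in>\<Sigma>. of_bool (A \<alpha> = \<sigma>))"
    by (subst sum.swap) (simp add: power2_eq_square flip: of_bool_conj)
  also have "\<dots> \<le> (\<Sum>\<alpha>\<in>?\<Omega>. 1)"
  proof (intro sum_mono)
    fix \<alpha>
    have "(\<Sum>\<sigma>\<in>\<Sigma>. of_bool (A \<alpha> = \<sigma>)) = (of_bool (A \<alpha> \<in> \<Sigma>) :: real)"
      using assms by (simp add: of_bool_def)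
    then show "(\<Sum>\<sigma>\<in>\<Sigma>. of_bool (A \<alpha> = \<sigma>)) \<le> (1 :: real)" by simp
  qed
  finally show ?thesis by simp
qed

lemma energy_nonneg: "0 \<le> energy d \<Sigma> A n f"
  by (simp add: energy_def sum_nonneg)

section \<open>Energy gained from witnesses of irregularity\<close>

text \<open>Each irregular block contributes separately. Its witness fills at least the proportion
  \<open>\<epsilon> ^ d\<close> of the volume \<open>m ^ d\<close>, and the density deviation there
  contributes a further factor \<open>\<epsilon>\<^sup>2\<close>.\<close>

lemma energy_increment:
  assumes fin: "finite \<Sigma>" and \<epsilon>: "0 < \<epsilon>" and eq: "equitable d n t m f"
    and W: "\<And>\<beta>. \<beta> \<in> irregular d \<Sigma> \<epsilon> A n t f \<Longrightarrow>
      block_of d (part n f \<beta>) (W \<beta>) \<and>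
      (\<forall>i\<in>{1..d}. real (card (W \<beta> i)) \<ge> \<epsilon> * real (card (part n f \<beta> i))) \<and>
      (\<exists>\<sigma>\<in>\<Sigma>. \<bar>block_density d A \<sigma> (W \<beta>) - block_density d A \<sigma> (part n f \<beta>)\<bar> > \<epsilon>)"
    and ref: "\<And>i u v. i \<in> {1..d} \<Longrightarrow> u \<in> {1..n} \<Longrightarrow> v \<in> {1..n} \<Longrightarrow> f' i u = f' i v \<Longrightarrow>
      f i u = f i v \<and> (\<forall>\<beta>\<in>irregular d \<Sigma> \<epsilon> A n t f. u \<in> W \<beta> i \<longleftrightarrow> v \<in> W \<beta> i)"
  shows "energy d \<Sigma> A n f' \<ge> energy d \<Sigma> A n f
    + real (card (irregular d \<Sigma> \<epsilon> A n t f)) * (\<epsilon> ^ (d + 2) * real m ^ d)"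
proof -
  let ?\<Omega> = "cells d (full (\<lambda>_. n))" and ?I = "irregular d \<Sigma> \<epsilon> A n t f"
  define x where "x \<sigma> = (\<lambda>\<alpha>. of_bool (A \<alpha> = \<sigma>) :: real)" for \<sigma>
  define D where "D \<sigma> \<alpha> = (cond_avg ?\<Omega> (grid d f') (x \<sigma>) \<alpha> - cond_avg ?\<Omega> (grid d f) (x \<sigma>) \<alpha>)\<^sup>2" for \<sigma> \<alpha>
  have Om: "\<alpha> i \<in> {1..n}" if "\<alpha> \<in> ?\<Omega>" "i \<in> {1..d}" for \<alpha> i
    using that by (auto simp: cells_def full_def)
  have gr: "f' i (\<alpha> i) = f' i (\<beta> i)" if "grid d f' \<alpha> = grid d f' \<beta>" "i \<in> {1..d}" for \<alpha> \<beta> i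
    using fun_cong[OF that(1), of i] that(2) by (simp add: grid_def)
  have "energy d \<Sigma> A n f' = energy d \<Sigma> A n f + (\<Sum>\<sigma>\<in>\<Sigma>. \<Sum>\<alpha>\<in>?\<Omega>. D \<sigma> \<alpha>)"
  proof -
    have coarse: "grid d f \<alpha> = grid d f \<beta>" if "\<alpha> \<in> ?\<Omega>" "\<beta> \<in> ?\<Omega>" "grid d f' \<alpha> = grid d f' \<beta>" for \<alpha> \<beta>
      unfolding grid_def
    proof (rule restrict_ext)
      fix i assume i: "i \<in> {1..d}"
      show "f i (\<alpha> i) = f i (\<beta> i)"
        using ref[OF i Om[OF that(1) i] Om[OF that(2) i] gr[OF that(3) i]] by (rule conjunct1)
    qed
    have "(\<Sum>\<alpha>\<in>?\<Omega>. (cond_avg ?\<Omega> (grid d f') (x \<sigma>) \<alpha>)\<^sup>2)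
        = (\<Sum>\<alpha>\<in>?\<Omega>. (cond_avg ?\<Omega> (grid d f) (x \<sigma>) \<alpha>)\<^sup>2) + (\<Sum>\<alpha>\<in>?\<Omega>. D \<sigma> \<alpha>)" for \<sigma>
      unfolding D_def by (rule sum_cond_avg_pythagoras[OF finite_cells_full coarse])
    moreover have "energy d \<Sigma> A n h = (\<Sum>\<sigma>\<in>\<Sigma>. \<Sum>\<alpha>\<in>?\<Omega>. (cond_avg ?\<Omega> (grid d h) (x \<sigma>) \<alpha>)\<^sup>2)" for h
      by (simp only: energy_def x_def)
    ultimately show ?thesis by (simp only: sum.distrib)
  qed
  moreover have "real (card ?I) * (\<epsilon> ^ (d + 2) * real m ^ d) \<le> (\<Sum>\<sigma>\<in>\<Sigma>. \<Sum>\<alpha>\<in>?\<Omega>. D \<sigma> \<alpha>)"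
  proof -
    have Isub: "?I \<subseteq> cells d (full (\<lambda>_. t))" by (auto simp: irregular_def)
    then have finI: "finite ?I" by (rule finite_subset) simp
    have ext: "\<beta> \<in> extensional {1..d}" if "\<beta> \<in> ?I" for \<beta>
      using that Isub by (auto simp: cells_def PiE_def)
    have ge: "\<epsilon> ^ (d + 2) * real m ^ d \<le> (\<Sum>\<sigma>\<in>\<Sigma>. \<Sum>\<alpha>\<in>cells d (part n f \<beta>). D \<sigma> \<alpha>)"
      if b: "\<beta> \<in> ?I" for \<beta>
    proof -
      let ?B = "cells d (W \<beta>)" and ?C = "cells d (part n f \<beta>)"
      from W[OF b] obtain \<sigma> where sub: "block_of d (part n f \<beta>) (W \<beta>)"
        and big: "\<forall>i\<in>{1..d}. real (card (W \<beta> i)) \<ge> \<epsilon> * real (card (part n f \<beta> i))"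
        and \<sigma>: "\<sigma> \<in> \<Sigma>" "\<bar>block_density d A \<sigma> (W \<beta>) - block_density d A \<sigma> (part n f \<beta>)\<bar> > \<epsilon>"
        by blast
      have m: "card (part n f \<beta> i) = m" if "i \<in> {1..d}" for i
      proof -
        have "\<beta> \<in> cells d (full (\<lambda>_. t))" using Isub b by blast
        then have "\<beta> i \<in> {1..t}" using that by (simp add: cells_def full_def PiE_iff)
        then show ?thesis using eq that by (simp add: equitable_def part_def)
      qed
      have C: "?C = {\<alpha>\<in>?\<Omega>. grid d f \<alpha> = \<beta>}" by (rule cells_part[OF ext[OF b]])
      then have finC: "finite ?C" by simp
      have BC: "?B \<subseteq> ?C" using sub by (auto simp: block_of_def cells_def intro!: PiE_mono)
      then have finB: "finite ?B" using finC by (rule finite_subset)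
      have "real (card ?B) = (\<Prod>i\<in>{1..d}. real (card (W \<beta> i)))" by (simp add: card_cells)
      also have "\<dots> \<ge> (\<Prod>i\<in>{1..d}. \<epsilon> * real m)"
        using big m \<epsilon> by (intro prod_mono) auto
      finally have vol: "real (card ?B) \<ge> \<epsilon> ^ d * real m ^ d" by (simp add: power_mult_distrib)
      have sq: "\<epsilon>\<^sup>2 \<le> (block_density d A \<sigma> (W \<beta>) - block_density d A \<sigma> (part n f \<beta>))\<^sup>2"
        using \<sigma>(2) \<epsilon> by (intro abs_le_square_iff[THEN iffD1]) linarith
      have "\<epsilon> ^ (d + 2) * real m ^ d = (\<epsilon> ^ d * real m ^ d) * \<epsilon>\<^sup>2"
        by (simp add: power_add power2_eq_square)
      also have "\<dots> \<le> real (card ?B) * (block_density d A \<sigma> (W \<beta>) - block_density d A \<sigma> (part n f \<beta>))\<^sup>2"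
        using vol sq by (intro mult_mono) auto
      also have "\<dots> = real (card ?B) * (sum (x \<sigma>) ?B / real (card ?B) - sum (x \<sigma>) ?C / real (card ?C))\<^sup>2"
        unfolding x_def by (simp only: sum_of_bool_cells[OF finB] sum_of_bool_cells[OF finC])
      also have "\<dots> \<le> (\<Sum>\<alpha>\<in>?C. D \<sigma> \<alpha>)"
        unfolding D_def
      \<comment> \<open>Fibres of the refined grid do not cross \<open>?B\<close>: by
        \<open>ref\<close>, within \<open>{1..n}\<close> membership in \<open>W \<beta> i\<close>
        depends only on the label under \<open>f' i\<close>.\<close>
      proof (rule sum_cond_avg_diff_ge[OF _ C BC])
        fix \<alpha> \<gamma> assume *: "\<alpha> \<in> ?B" "\<gamma> \<in> ?\<Omega>" "grid d f' \<alpha> = grid d f' \<gamma>"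
        have a: "\<alpha> \<in> ?\<Omega>" using BC C *(1) by auto
        have "\<gamma> i \<in> W \<beta> i" if i: "i \<in> {1..d}" for i
          using ref[OF i Om[OF a i] Om[OF *(2) i] gr[OF *(3) i]] b *(1) i by (auto simp: cells_def)
        then show "\<gamma> \<in> ?B" using *(2) by (auto simp: cells_def PiE_iff)
      qed simp
      also have "\<dots> \<le> (\<Sum>\<sigma>\<in>\<Sigma>. \<Sum>\<alpha>\<in>?C. D \<sigma> \<alpha>)"
        using \<sigma>(1) fin by (intro member_le_sum) (auto simp: D_def intro: sum_nonneg)
      finally show ?thesis .
    qed
    have "real (card ?I) * (\<epsilon> ^ (d + 2) * real m ^ d)
        \<le> (\<Sum>\<beta>\<in>?I. \<Sum>\<sigma>\<in>\<Sigma>. \<Sum>\<alpha>\<in>cells d (part n f \<beta>). D \<sigma> \<alpha>)"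
      by (rule sum_bounded_below) (rule ge)
    also have "\<dots> = (\<Sum>\<sigma>\<in>\<Sigma>. \<Sum>\<beta>\<in>?I. \<Sum>\<alpha>\<in>cells d (part n f \<beta>). D \<sigma> \<alpha>)"
      by (rule sum.swap)
    \<comment> \<open>Different \<open>\<beta>\<close> belong to different fibres of
      \<open>grid d f\<close>, so the blocks are disjoint and their gains add up.\<close>
    also have "\<dots> = (\<Sum>\<sigma>\<in>\<Sigma>. \<Sum>\<alpha>\<in>(\<Union>\<beta>\<in>?I. cells d (part n f \<beta>)). D \<sigma> \<alpha>)"
      by (intro sum.cong refl sum.UNION_disjoint[symmetric] finI ballI impI)
        (auto simp: cells_part[OF ext])
    also have "\<dots> \<le> (\<Sum>\<sigma>\<in>\<Sigma>. \<Sum>\<alpha>\<in>?\<Omega>. D \<sigma> \<alpha>)"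
      by (intro sum_mono sum_mono2) (auto simp: cells_part[OF ext] D_def)
    finally show ?thesis .
  qed
  ultimately show ?thesis by simp
qed

section \<open>Counting and refining the ordinary parts\<close>

lemma equitable_card_ordinary:
  assumes eq: "equitable d n t m f" and i: "i \<in> {1..d}"
  shows "card {v\<in>{1..n}. f i v \<in> {1..t}} = t * m"
proof -
  have "{v\<in>{1..n}. f i v \<in> {1..t}} = (\<Union>j\<in>{1..t}. {v\<in>{1..n}. f i v = j})" by auto
  also have "card \<dots> = (\<Sum>j\<in>{1..t}. card {v\<in>{1..n}. f i v = j})"
    by (rule card_UN_disjoint) auto
  also have "\<dots> = t * m" using eq i by (simp add: equitable_def)
  finally show ?thesis .
qed

lemma equitable_le:
  assumes "equitable d n t m f" and "d \<ge> 1"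
  shows "t * m \<le> n"
proof -
  have "card {v\<in>{1..n}. f 1 v \<in> {1..t}} \<le> card {1..n}" by (rule card_mono) auto
  then show ?thesis using equitable_card_ordinary[OF assms(1), of 1] assms(2) by simp
qed

text \<open>Only ordinary indices are cut again, and \<open>L * m'\<close> is the reserve that the
  greedy cutting needs. Because every exceptional index has a label of its own, the refinement
  property holds for all pairs of indices.\<close>

lemma equitable_refine:
  fixes g :: "nat \<Rightarrow> nat \<Rightarrow> 'l"
  assumes eq: "equitable d n t m f"
    and L: "\<And>i. i \<in> {1..d} \<Longrightarrow> card (g i ` {v\<in>{1..n}. f i v \<in> {1..t}}) \<le> L"
    and size: "k * m' + L * m' \<le> t * m"
  obtains f' where "equitable d n k m' f'"
    and "\<And>i u v. i \<in> {1..d} \<Longrightarrow> u \<in> {1..n} \<Longrightarrow> v \<in> {1..n} \<Longrightarrow> f' i u = f' i v \<Longrightarrow> g i u = g i v"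
proof -
  define P where "P i = {v\<in>{1..n}. f i v \<in> {1..t}}" for i
  have ex: "\<forall>i\<in>{1..d}. \<exists>h. (\<forall>l<k. card {v\<in>P i. h v = l} = m') \<and> (\<forall>v\<in>P i. h v \<le> k) \<and>
        (\<forall>u\<in>P i. \<forall>v\<in>P i. h u = h v \<longrightarrow> h u < k \<longrightarrow> g i u = g i v)"
  proof
    fix i assume i: "i \<in> {1..d}"
    show "\<exists>h. (\<forall>l<k. card {v\<in>P i. h v = l} = m') \<and> (\<forall>v\<in>P i. h v \<le> k) \<and>
        (\<forall>u\<in>P i. \<forall>v\<in>P i. h u = h v \<longrightarrow> h u < k \<longrightarrow> g i u = g i v)"
      by (rule chop_into_equal_pieces[where L = L])
        (use L[OF i] size equitable_card_ordinary[OF eq i] in \<open>auto simp: P_def\<close>)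
  qed
  from bchoice[OF ex] obtain h where h: "\<forall>i\<in>{1..d}. (\<forall>l<k. card {v\<in>P i. h i v = l} = m') \<and> (\<forall>v\<in>P i. h i v \<le> k) \<and>
        (\<forall>u\<in>P i. \<forall>v\<in>P i. h i u = h i v \<longrightarrow> h i u < k \<longrightarrow> g i u = g i v)"
    by (rule exE)
  \<comment> \<open>The pieces \<open>0, ..., k - 1\<close> are shifted to the labels
    \<open>1, ..., k\<close>. The label \<open>k + v\<close> exceeds \<open>k\<close> because
    indices start at 1, and it determines \<open>v\<close>.\<close>
  define f' where "f' i v = (if v \<in> P i \<and> h i v < k then Suc (h i v) else k + v)" for i v
  show ?thesis
  proof (rule that)
    show "equitable d n k m' f'"
      unfolding equitable_def
    proof (intro ballI conjI)
      fix i j assume i: "i \<in> {1..d}" and j: "j \<in> {1..k}"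
      have "{v\<in>{1..n}. f' i v = j} = {v\<in>P i. h i v = j - 1}"
        using j by (auto simp: f'_def P_def)
      then show "card {v\<in>{1..n}. f' i v = j} = m'" using bspec[OF h i] j by auto
    next
      fix i v
      show "f' i v \<in> {1..k} \<or> f' i v = k + v" by (auto simp: f'_def)
    qed
    show "g i u = g i v" if "i \<in> {1..d}" "u \<in> {1..n}" "v \<in> {1..n}" "f' i u = f' i v" for i u v
    proof (cases "f' i u \<le> k")
      case True
      then have "u \<in> P i" "h i u < k" "v \<in> P i" "h i u = h i v"
        using that(2-4) by (auto simp: f'_def split: if_splits)
      then show ?thesis using bspec[OF h that(1)] by blast
    next
      case False
      then have "u = v" using that(4) by (auto simp: f'_def split: if_splits)
      then show ?thesis by simp
    qed
  qed
qed

section \<open>One round of refinement\<close>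

text \<open>More than \<open>\<epsilon> * t ^ d\<close> irregular blocks, each gaining
  \<open>\<epsilon> ^ (d + 2) * m ^ d\<close>, give
  \<open>\<epsilon> ^ (d + 3) * (t * m) ^ d\<close>; the factor 1/2 comes from \<open>half\<close>.
  The last conclusion bounds the number of indices that become exceptional in each coordinate, and
  large \<open>K\<close> makes it small.\<close>

lemma irregular_step:
  assumes fin: "finite \<Sigma>" and \<epsilon>: "0 < \<epsilon>" and d: "d \<ge> 1" and K: "K \<ge> 1" and t: "t \<ge> 1"
    and eq: "equitable d n t m f"
    and irr: "real (card (irregular d \<Sigma> \<epsilon> A n t f)) > \<epsilon> * real t ^ d"
    and half: "real n ^ d / 2 \<le> real (t * m) ^ d"
    and n: "K * (K + 1) * (t * 2 ^ (t ^ d)) \<le> n"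
  obtains m' f' where "equitable d n (K * (t * 2 ^ (t ^ d))) m' f'"
    and "energy d \<Sigma> A n f' \<ge> energy d \<Sigma> A n f + \<epsilon> ^ (d + 3) / 2 * real n ^ d"
    and "real (t * m) - real (K * (t * 2 ^ (t ^ d)) * m') \<le> 2 * real n / real K"
proof -
  let ?I = "irregular d \<Sigma> \<epsilon> A n t f"
  \<comment> \<open>\<open>L\<close> bounds the number of values of \<open>g\<close> below:
    \<open>t\<close> old labels times the subsets of the \<open>t ^ d\<close> ordinary
    blocks.\<close>
  define L where "L = t * 2 ^ (t ^ d)"
  \<comment> \<open>Divisor \<open>K + 1\<close> instead of \<open>K\<close>: \<open>K * L\<close>
    pieces are cut, and \<open>L\<close> further pieces' worth of indices stays as reserve.\<close>
  define m' where "m' = t * m div ((K + 1) * L)"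
  have "\<forall>\<beta>\<in>?I. \<exists>B. block_of d (part n f \<beta>) B \<and>
      (\<forall>i\<in>{1..d}. real (card (B i)) \<ge> \<epsilon> * real (card (part n f \<beta> i))) \<and>
      (\<exists>\<sigma>\<in>\<Sigma>. \<bar>block_density d A \<sigma> B - block_density d A \<sigma> (part n f \<beta>)\<bar> > \<epsilon>)"
    by (auto simp: irregular_def regular_block_def not_le)
  then obtain W where W: "\<And>\<beta>. \<beta> \<in> ?I \<Longrightarrow>
      block_of d (part n f \<beta>) (W \<beta>) \<and>
      (\<forall>i\<in>{1..d}. real (card (W \<beta> i)) \<ge> \<epsilon> * real (card (part n f \<beta> i))) \<and>
      (\<exists>\<sigma>\<in>\<Sigma>. \<bar>block_density d A \<sigma> (W \<beta>) - block_density d A \<sigma> (part n f \<beta>)\<bar> > \<epsilon>)"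
    by metis
  \<comment> \<open>Common refinement, in each coordinate, of the old parts and of all witness
    sets.\<close>
  define g where "g i v = (f i v, {\<beta>\<in>?I. v \<in> W \<beta> i})" for i v
  have cL: "card (g i ` {v\<in>{1..n}. f i v \<in> {1..t}}) \<le> L" for i
  proof -
    have "g i ` {v\<in>{1..n}. f i v \<in> {1..t}} \<subseteq> {1..t} \<times> Pow (cells d (full (\<lambda>_. t)))"
      by (auto simp: g_def irregular_def)
    then have "card (g i ` {v\<in>{1..n}. f i v \<in> {1..t}}) \<le> card ({1..t} \<times> Pow (cells d (full (\<lambda>_. t))))"
      by (intro card_mono) auto
    then show ?thesis by (simp add: L_def card_cartesian_product card_Pow)
  qed
  have "K * L * m' + L * m' = (K + 1) * L * m'" by (simp add: algebra_simps)
  also have "\<dots> \<le> t * m" unfolding m'_def by (rule times_div_less_eq_dividend)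
  finally have size: "K * L * m' + L * m' \<le> t * m" .
  obtain f' where f': "equitable d n (K * L) m' f'"
    and ref: "\<And>i u v. i \<in> {1..d} \<Longrightarrow> u \<in> {1..n} \<Longrightarrow> v \<in> {1..n} \<Longrightarrow> f' i u = f' i v \<Longrightarrow> g i u = g i v"
    using equitable_refine[OF eq cL size] by metis
  show ?thesis
  proof (rule that)
    show "equitable d n (K * (t * 2 ^ (t ^ d))) m' f'" using f' by (simp add: L_def)
    have "\<epsilon> ^ (d + 3) / 2 * real n ^ d = \<epsilon> ^ (d + 3) * (real n ^ d / 2)" by simp
    also have "\<dots> \<le> \<epsilon> ^ (d + 3) * real (t * m) ^ d"
      using half \<epsilon> by (intro mult_left_mono) auto
    also have "\<dots> = (\<epsilon> * real t ^ d) * (\<epsilon> ^ (d + 2) * real m ^ d)"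
      by (simp add: power_add power_mult_distrib eval_nat_numeral)
    also have "\<dots> \<le> real (card ?I) * (\<epsilon> ^ (d + 2) * real m ^ d)"
      using irr \<epsilon> by (intro mult_right_mono) auto
    finally have gain: "\<epsilon> ^ (d + 3) / 2 * real n ^ d \<le> \<dots>" .
    have "energy d \<Sigma> A n f' \<ge> energy d \<Sigma> A n f + real (card ?I) * (\<epsilon> ^ (d + 2) * real m ^ d)"
    proof (rule energy_increment[OF fin \<epsilon> eq W])
      fix i u v assume *: "i \<in> {1..d}" "u \<in> {1..n}" "v \<in> {1..n}" "f' i u = f' i v"
      show "f i u = f i v \<and> (\<forall>\<beta>\<in>?I. u \<in> W \<beta> i \<longleftrightarrow> v \<in> W \<beta> i)"
        using ref[OF *] unfolding g_def by blast
    qed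
    then show "energy d \<Sigma> A n f' \<ge> energy d \<Sigma> A n f + \<epsilon> ^ (d + 3) / 2 * real n ^ d"
      using gain by linarith
    have Lpos: "L \<ge> 1" using t by (simp add: L_def)
    have tm: "t * m \<le> n" by (rule equitable_le[OF eq d])
    \<comment> \<open>The loss consists of the reserve \<open>L * m'\<close> and a rounding error
      below \<open>(K + 1) * L\<close>. Each is at most \<open>n / K\<close>, by \<open>size\<close>
      and by the assumption on \<open>n\<close> respectively.\<close>
    have "t * m < (K + 1) * L * m' + (K + 1) * L"
      unfolding m'_def using Lpos
      by (metis add.commute dividend_less_times_div add_gr_0 less_one less_le_trans mult_pos_pos zero_less_one)
    then have "t * m - K * L * m' \<le> L * m' + (K + 1) * L" by (simp add: algebra_simps)
    moreover have "K * (L * m') \<le> n" using size tm by (simp add: mult.assoc)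
    moreover have "K * ((K + 1) * L) \<le> n" using n by (simp only: L_def mult.assoc)
    ultimately have "K * (t * m - K * L * m') \<le> n + n"
      by (smt (verit) add_mono distrib_left mult_le_mono2 order_trans)
    then have "real K * real (t * m - K * L * m') \<le> 2 * real n"
      by (metis mult_2 of_nat_add of_nat_le_iff of_nat_mult)
    then have "real (t * m - K * L * m') \<le> 2 * real n / real K"
      using K by (simp add: field_simps)
    moreover have "K * L * m' \<le> t * m" using size by simp
    ultimately show "real (t * m) - real (K * (t * 2 ^ (t ^ d)) * m') \<le> 2 * real n / real K"
      by (simp add: L_def of_nat_diff)
  qed
qed

section \<open>From labellings to block partitions\<close>

text \<open>The singleton exceptional parts were convenient for the energy; here they are merged
  into a single part with label \<open>t + 1\<close> in each coordinate. A block is ordinary when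
  all its labels are at most \<open>t\<close>.\<close>

lemma regular_partition_of_equitable:
  assumes d: "d \<ge> 1" and n: "n \<ge> 1" and eq: "equitable d n t m f" and m: "m \<ge> 1"
    and irr: "real (card (irregular d \<Sigma> \<epsilon> A n t f)) \<le> \<epsilon> * real t ^ d"
    and cover: "(1 - \<epsilon>) * real n ^ d \<le> real (t * m) ^ d"
  obtains s \<B> R where "regular_partition d \<Sigma> \<epsilon> A (full (\<lambda>_. n)) s \<B> R" "partition_card R = t ^ d"
proof -
  \<comment> \<open>The extra part is present only when it is nonempty, as blocks of a partition
    must be. One test serves all coordinates, since each has exactly \<open>t * m\<close> ordinary
    indices.\<close>
  define s where "s = (\<lambda>i::nat. if t * m < n then t + 1 else t)"
  \<comment> \<open>Outside \<open>{1..d}\<close> the value of an extensional \<open>\<beta>\<close>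
    is \<open>undefined\<close>, which might exceed \<open>t\<close>. The guard on \<open>i\<close>
    makes \<open>\<B> \<beta>\<close> and \<open>part n f \<beta>\<close> equal as functions for
    \<open>\<beta> \<in> R\<close>.\<close>
  define P where "P i j = (if i \<in> {1..d} \<and> j > t then {v\<in>{1..n}. f i v > t} else {v\<in>{1..n}. f i v = j})"
    for i j
  define \<B> where "\<B> \<beta> = (\<lambda>i. P i (\<beta> i))" for \<beta> :: index
  define R where "R = cells d (full (\<lambda>_. t))"
  define U where "U = (\<lambda>i. {v\<in>{1..n}. f i v \<in> {1..t}})"
  let ?\<Omega> = "cells d (full (\<lambda>_. n))" and ?S = "cells d (full s)"
  have fpos: "f i v \<ge> 1" if "i \<in> {1..d}" "v \<in> {1..n}" for i v
    using eq that unfolding equitable_def by fastforce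
  have cm: "card {v\<in>{1..n}. f i v = j} = m" if "i \<in> {1..d}" "j \<in> {1..t}" for i j
    using eq that by (simp add: equitable_def)
  have cU: "card (U i) = t * m" if "i \<in> {1..d}" for i
    unfolding U_def by (rule equitable_card_ordinary[OF eq that])
  have Psub: "P i j \<subseteq> {1..n}" for i j by (auto simp: P_def)
  have Pne: "P i j \<noteq> {}" if i: "i \<in> {1..d}" and j: "j \<in> {1..s i}" for i j
  proof (cases "j \<le> t")
    case True
    then have "card (P i j) \<ge> 1" using cm[OF i] j m by (simp add: P_def)
    then show ?thesis by auto
  next
    case False
    then have "t * m < n" using j by (auto simp: s_def split: if_splits)
    then have "U i \<noteq> {1..n}" using cU[OF i] by auto
    then obtain v where "v \<in> {1..n}" "v \<notin> U i" unfolding U_def by blast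
    then have v: "v \<in> {1..n}" "f i v > t" using fpos[OF i] by (auto simp: U_def)
    then show ?thesis using False i by (auto simp: P_def)
  qed
  have Pdisj: "j = j'" if "i \<in> {1..d}" "j \<in> {1..s i}" "j' \<in> {1..s i}" "v \<in> P i j" "v \<in> P i j'" for i j j' v
    using that by (auto simp: P_def s_def split: if_splits)
  have Pcov: "\<exists>j\<in>{1..s i}. v \<in> P i j" if i: "i \<in> {1..d}" and v: "v \<in> {1..n}" for i v
  proof (cases "f i v \<le> t")
    case True
    then show ?thesis using i v fpos[OF i v] by (intro bexI[of _ "f i v"]) (auto simp: P_def s_def)
  next
    case False
    then have "v \<notin> U i" by (auto simp: U_def)
    moreover have "U i \<subseteq> {1..n}" by (auto simp: U_def)
    ultimately have "U i \<subset> {1..n}" using v by blast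
    then have "card (U i) < card {1..n}" by (rule psubset_card_mono[rotated]) simp
    then have "t * m < n" using cU[OF i] by simp
    then show ?thesis using i v False by (intro bexI[of _ "t + 1"]) (auto simp: P_def s_def)
  qed
  have RS: "R \<subseteq> ?S" unfolding R_def cells_def full_def s_def by (intro PiE_mono) auto
  have disj: "disjoint_family_on (\<lambda>\<beta>. cells d (\<B> \<beta>)) ?S"
    unfolding disjoint_family_on_def
  proof (intro ballI impI, rule ccontr)
    fix \<beta> \<gamma> assume *: "\<beta> \<in> ?S" "\<gamma> \<in> ?S" "\<beta> \<noteq> \<gamma>" "cells d (\<B> \<beta>) \<inter> cells d (\<B> \<gamma>) \<noteq> {}"
    then obtain \<alpha> where \<alpha>: "\<alpha> \<in> cells d (\<B> \<beta>)" "\<alpha> \<in> cells d (\<B> \<gamma>)" by blast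
    have "\<beta> = \<gamma>"
    proof (rule PiE_ext)
      show "\<beta> \<in> (\<Pi>\<^sub>E i\<in>{1..d}. {1..s i})" "\<gamma> \<in> (\<Pi>\<^sub>E i\<in>{1..d}. {1..s i})"
        using * by (auto simp: cells_def full_def)
      fix i assume i: "i \<in> {1..d}"
      have "\<beta> i \<in> {1..s i}" "\<gamma> i \<in> {1..s i}" "\<alpha> i \<in> P i (\<beta> i)" "\<alpha> i \<in> P i (\<gamma> i)"
        using *(1,2) \<alpha> i by (simp_all add: cells_def full_def \<B>_def PiE_iff)
      then show "\<beta> i = \<gamma> i" by (rule Pdisj[OF i])
    qed
    then show False using *(3) by simp
  qed
  have cov: "(\<Union>\<beta>\<in>?S. cells d (\<B> \<beta>)) = ?\<Omega>"
  proof (intro equalityI subsetI)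
    fix \<alpha> assume "\<alpha> \<in> (\<Union>\<beta>\<in>?S. cells d (\<B> \<beta>))"
    then show "\<alpha> \<in> ?\<Omega>" using Psub by (fastforce simp: cells_def full_def \<B>_def PiE_iff)
  next
    fix \<alpha> assume a: "\<alpha> \<in> ?\<Omega>"
    then have ex: "\<forall>i\<in>{1..d}. \<exists>j. j \<in> {1..s i} \<and> \<alpha> i \<in> P i j"
      using Pcov unfolding cells_def full_def PiE_iff by blast
    from bchoice[OF ex] obtain b where "\<forall>i\<in>{1..d}. b i \<in> {1..s i} \<and> \<alpha> i \<in> P i (b i)" by (rule exE)
    then have "restrict b {1..d} \<in> ?S" "\<alpha> \<in> cells d (\<B> (restrict b {1..d}))"
      using a by (auto simp: cells_def full_def \<B>_def PiE_iff)
    then show "\<alpha> \<in> (\<Union>\<beta>\<in>?S. cells d (\<B> \<beta>))" by blast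
  qed
  have BR: "\<B> \<beta> = part n f \<beta>" if "\<beta> \<in> R" for \<beta>
  proof
    fix i
    have "\<beta> i \<in> {1..t}" if "i \<in> {1..d}"
      using \<open>\<beta> \<in> R\<close> that by (simp add: R_def cells_def full_def PiE_iff)
    then show "\<B> \<beta> i = part n f \<beta> i" by (auto simp: \<B>_def P_def part_def)
  qed
  have covU: "(\<Union>\<beta>\<in>R. cells d (\<B> \<beta>)) = cells d U"
  proof -
    have "cells d (\<B> \<beta>) = {\<alpha>\<in>?\<Omega>. grid d f \<alpha> = \<beta>}" if "\<beta> \<in> R" for \<beta>
      unfolding BR[OF that] by (rule cells_part) (use that in \<open>simp add: R_def cells_def PiE_iff\<close>)
    then have "(\<Union>\<beta>\<in>R. cells d (\<B> \<beta>)) = {\<alpha>\<in>?\<Omega>. grid d f \<alpha> \<in> R}" by auto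
    also have "\<dots> = {\<alpha>\<in>?\<Omega>. \<forall>i\<in>{1..d}. f i (\<alpha> i) \<in> {1..t}}"
      by (simp add: R_def grid_def full_def cells_def PiE_iff)
    also have "\<dots> = cells d U"
      by (rule set_eqI) (simp add: U_def cells_def full_def PiE_iff; blast)
    finally show ?thesis .
  qed
  have Usub: "block_of d (full (\<lambda>_. n)) U" by (auto simp: block_of_def full_def U_def)
  have part: "block_partition d (full (\<lambda>_. n)) s \<B> R"
    unfolding block_partition_def
  proof (intro conjI ballI)
    fix \<beta> assume b: "\<beta> \<in> ?S"
    show "block_of d (full (\<lambda>_. n)) (\<B> \<beta>)" using Psub by (auto simp: block_of_def full_def \<B>_def)
    show "cells d (\<B> \<beta>) \<noteq> {}"
      using b Pne by (auto simp: cells_def full_def \<B>_def PiE_eq_empty_iff PiE_iff)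
  next
    show "\<exists>P. \<forall>\<beta>\<in>?S. \<forall>i\<in>{1..d}. \<B> \<beta> i = P i (\<beta> i)" by (rule exI[of _ P]) (simp add: \<B>_def)
    show "\<exists>U. block_of d (full (\<lambda>_. n)) U \<and> (\<Union>\<beta>\<in>R. cells d (\<B> \<beta>)) = cells d U"
      using Usub covU by blast
  qed (fact disj cov RS)+
  have bal: "balanced_partition d (full (\<lambda>_. n)) s \<B> R t"
    unfolding balanced_partition_def
  proof (intro conjI part exI[of _ m] exI[of _ U] Usub covU ballI)
    fix \<beta> i assume *: "\<beta> \<in> R" "i \<in> {1..d}"
    then have "\<beta> i \<in> {1..t}" by (auto simp: R_def cells_def full_def)
    then show "card (\<B> \<beta> i) = m" using cm[OF *(2)] by (simp add: BR[OF *(1)] part_def)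
  qed (rule cU)
  have finB: "finite (cells d (\<B> \<beta>))" for \<beta>
    unfolding \<B>_def by (intro finite_cells finite_subset[OF Psub]) simp
  \<comment> \<open>The exceptional volume is found by subtraction: all blocks together fill
    \<open>n ^ d\<close> cells, the ordinary ones \<open>(t * m) ^ d\<close>.\<close>
  have "(\<Sum>\<beta>\<in>?S. block_volume d (\<B> \<beta>)) = card (\<Union>\<beta>\<in>?S. cells d (\<B> \<beta>))"
    unfolding block_volume_def
    by (rule card_UN_disjoint[symmetric]) (use disj finB in \<open>auto simp: disjoint_family_on_def\<close>)
  moreover have "(\<Sum>\<beta>\<in>R. block_volume d (\<B> \<beta>)) = card (\<Union>\<beta>\<in>R. cells d (\<B> \<beta>))"
    unfolding block_volume_def
    by (rule card_UN_disjoint[symmetric])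
      (use disj finB RS in \<open>auto simp: disjoint_family_on_def R_def\<close>)
  moreover have "card (cells d U) = (t * m) ^ d" by (rule card_cells_const) (rule cU)
  moreover have "(\<Sum>\<beta>\<in>?S. block_volume d (\<B> \<beta>))
      = (\<Sum>\<beta>\<in>?S - R. block_volume d (\<B> \<beta>)) + (\<Sum>\<beta>\<in>R. block_volume d (\<B> \<beta>))"
    by (rule sum.subset_diff[OF RS]) simp
  ultimately have "n ^ d = (\<Sum>\<beta>\<in>?S - R. block_volume d (\<B> \<beta>)) + (t * m) ^ d"
    by (simp only: cov covU card_cells_full)
  then have "real n ^ d = real (\<Sum>\<beta>\<in>?S - R. block_volume d (\<B> \<beta>)) + real (t * m) ^ d"
    by (metis of_nat_add of_nat_power)
  then have exc: "real (\<Sum>\<beta>\<in>?S - R. block_volume d (\<B> \<beta>)) \<le> \<epsilon> * real (block_volume d (full (\<lambda>_. n)))"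
    using cover by (simp add: block_volume_def algebra_simps del: of_nat_sum)
  have "{\<beta>\<in>R. \<not> regular_block d \<Sigma> \<epsilon> A (\<B> \<beta>)} = irregular d \<Sigma> \<epsilon> A n t f"
    using BR by (auto simp: irregular_def R_def)
  then have "regular_partition d \<Sigma> \<epsilon> A (full (\<lambda>_. n)) s \<B> R"
    unfolding regular_partition_def using bal exc irr by (auto simp: partition_card_def R_def)
  moreover have "partition_card R = t ^ d" by (simp add: partition_card_def R_def)
  ultimately show ?thesis by (rule that)
qed

section \<open>Choice of the constants and the iteration\<close>

theorem theorem3:
  fixes d :: nat and \<Sigma> :: "'a set" and \<epsilon> :: real
  assumes "d \<ge> 1" and "finite \<Sigma>" and "0 < \<epsilon>" and "\<epsilon> < 1/2"
  shows "\<exists>N T :: nat. \<forall>n\<ge>N. \<forall>A. matrix_over d \<Sigma> (\<lambda>i. n) A \<longrightarrow>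
           (\<exists>s \<B> R. regular_partition d \<Sigma> \<epsilon> A (full (\<lambda>i. n)) s \<B> R \<and> partition_card R \<le> T)"
proof -
  \<comment> \<open>\<open>c * n ^ d\<close> is the energy gain of one round, so \<open>q\<close>
    rounds would exceed the maximal energy \<open>n ^ d\<close>.\<close>
  define c where "c = \<epsilon> ^ (d + 3) / 2"
  have c: "c > 0" using assms by (simp add: c_def)
  obtain q :: nat where q: "real q * c > 1" using c ex_less_of_nat_mult by blast
  \<comment> \<open>A round loses at most \<open>2 * n / K\<close> indices per coordinate;
    \<open>K\<close> is chosen so that \<open>q\<close> rounds lose at most
    \<open>\<epsilon> * n / d\<close>.\<close>
  obtain K0 :: nat where K0: "real K0 > 2 * real q * real d / \<epsilon>" using reals_Archimedean2 by blast
  define K where "K = Suc K0"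
  have K: "K \<ge> 1" "2 * real q / real K \<le> \<epsilon> / real d"
    using K0 assms by (auto simp: K_def field_simps intro: order_trans[OF less_imp_le])
  \<comment> \<open>\<open>\<tau> r\<close> is the number of ordinary parts per coordinate after
    \<open>r\<close> rounds, independent of \<open>n\<close> and \<open>A\<close>.\<close>
  define \<tau> where "\<tau> r = ((\<lambda>t. K * (t * 2 ^ (t ^ d))) ^^ r) 1" for r
  have \<tau>0: "\<tau> 0 = 1" and \<tau>S: "\<tau> (Suc r) = K * (\<tau> r * 2 ^ (\<tau> r ^ d))" for r
    by (simp_all add: \<tau>_def)
  have \<tau>: "\<tau> r \<ge> 1" for r using K(1) by (induction r) (simp_all add: \<tau>0 \<tau>S)
  \<comment> \<open>The sums in \<open>N\<close> and \<open>T\<close> serve as upper bounds for all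
    their terms, so that every round up to \<open>q\<close> is covered at once.\<close>
  define N where "N = 1 + (\<Sum>r\<le>q. K * (K + 1) * (\<tau> r * 2 ^ (\<tau> r ^ d)))"
  define T where "T = (\<Sum>r\<le>q. \<tau> r ^ d)"
  show ?thesis
  proof (rule exI[of _ N], rule exI[of _ T], intro allI impI)
    fix n A assume nN: "N \<le> n"
    then have n: "n \<ge> 1" by (simp add: N_def)
    have nr: "K * (K + 1) * (\<tau> r * 2 ^ (\<tau> r ^ d)) \<le> n" if "r \<le> q" for r
      using member_le_sum[of r "{..q}" "\<lambda>r. K * (K + 1) * (\<tau> r * 2 ^ (\<tau> r ^ d))"] that nN
      by (simp add: N_def)
    have cover: "(1 - \<epsilon>) * real n ^ d \<le> real (t * m) ^ d"
      if r: "r \<le> q" and tm: "real n - real (t * m) \<le> real r * (2 * real n / real K)" for r t m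
    proof -
      have "real r * (2 * real n / real K) \<le> (2 * real q / real K) * real n"
        using r by (simp add: divide_simps mult_right_mono)
      also have "\<dots> \<le> \<epsilon> / real d * real n" by (intro mult_right_mono K) simp
      finally have tm': "(1 - \<epsilon> / real d) * real n \<le> real (t * m)" using tm by (simp add: algebra_simps)
      have e1: "\<epsilon> / real d \<le> 1" using assms by (simp add: divide_simps)
      \<comment> \<open>Bernoulli's inequality: losing the proportion \<open>\<epsilon> / d\<close>
        in each of the \<open>d\<close> coordinates costs at most the proportion
        \<open>\<epsilon>\<close> of the volume.\<close>
      have "1 - \<epsilon> \<le> (1 - \<epsilon> / real d) ^ d"
        using Bernoulli_inequality[of "- (\<epsilon> / real d)" d] e1 assms(1) by simp
      then have "(1 - \<epsilon>) * real n ^ d \<le> ((1 - \<epsilon> / real d) * real n) ^ d"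
        by (simp add: power_mult_distrib mult_right_mono)
      also have "\<dots> \<le> real (t * m) ^ d" by (intro power_mono tm') (use e1 in simp)
      finally show ?thesis .
    qed
    show "\<exists>s \<B> R. regular_partition d \<Sigma> \<epsilon> A (full (\<lambda>i. n)) s \<B> R \<and> partition_card R \<le> T"
    \<comment> \<open>If no partition works, every labelling reached within \<open>q\<close> rounds
      has too many irregular blocks, so the refinement never stops early.\<close>
    proof (rule ccontr)
      assume none: "\<not> ?thesis"
      have irr: "real (card (irregular d \<Sigma> \<epsilon> A n (\<tau> r) f)) > \<epsilon> * real (\<tau> r) ^ d"
        if r: "r \<le> q" and eq: "equitable d n (\<tau> r) m f"
          and tm: "real n - real (\<tau> r * m) \<le> real r * (2 * real n / real K)" for r m f
      proof (rule ccontr)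
        assume *: "\<not> ?thesis"
        \<comment> \<open>The ordinary part has positive volume, which excludes empty parts.\<close>
        have "0 < (1 - \<epsilon>) * real n ^ d" using n assms by simp
        also note cover[OF r tm]
        finally have "m \<ge> 1" using assms(1) by (cases m) (auto simp: power_0_left)
        then obtain s \<B> R where "regular_partition d \<Sigma> \<epsilon> A (full (\<lambda>_. n)) s \<B> R" "partition_card R = \<tau> r ^ d"
          using regular_partition_of_equitable[OF assms(1) n eq _ _ cover[OF r tm]] * by (metis not_le)
        moreover have "\<tau> r ^ d \<le> T"
          unfolding T_def using r by (intro member_le_sum) auto
        ultimately show False using none by metis
      qed
      \<comment> \<open>Invariant after \<open>r\<close> rounds: the loss is at most
        \<open>r\<close> times, and the energy at least \<open>r\<close> times, the amount of one
        round. The start is a single part containing all indices in each coordinate.\<close>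
      have "\<exists>m f. equitable d n (\<tau> r) m f \<and> real n - real (\<tau> r * m) \<le> real r * (2 * real n / real K) \<and>
          energy d \<Sigma> A n f \<ge> real r * (c * real n ^ d)" if "r \<le> q" for r
        using that
      proof (induction r)
        case 0
        have "{v. v \<in> {1..n}} = {1..n}" by auto
        then have "equitable d n (\<tau> 0) n (\<lambda>_ _. 1)" by (simp add: equitable_def \<tau>0)
        then show ?case using energy_nonneg \<tau>0 by (intro exI[of _ n] exI[of _ "\<lambda>_ _. 1"]) auto
      next
        case (Suc r)
        then obtain m f where *: "equitable d n (\<tau> r) m f"
            "real n - real (\<tau> r * m) \<le> real r * (2 * real n / real K)"
            "energy d \<Sigma> A n f \<ge> real r * (c * real n ^ d)" by auto
        have r: "r \<le> q" using Suc by simp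
        \<comment> \<open>Here \<open>\<epsilon> < 1/2\<close> enters: at least half of the volume
          remains ordinary.\<close>
        have "real n ^ d / 2 \<le> (1 - \<epsilon>) * real n ^ d"
          using assms mult_right_mono[of "1/2" "1 - \<epsilon>" "real n ^ d"] by simp
        also note cover[OF r *(2)]
        finally have half: "real n ^ d / 2 \<le> real (\<tau> r * m) ^ d" .
        obtain m' f' where "equitable d n (\<tau> (Suc r)) m' f'"
          "energy d \<Sigma> A n f' \<ge> energy d \<Sigma> A n f + c * real n ^ d"
          "real (\<tau> r * m) - real (\<tau> (Suc r) * m') \<le> 2 * real n / real K"
          using irregular_step[OF assms(2,3,1) K(1) \<tau> *(1) irr[OF r *(1,2)] half nr[OF r]]
          unfolding c_def \<tau>S by metis
        then show ?case using *(2,3)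
          by (intro exI[of _ m'] exI[of _ f']) (auto simp: algebra_simps add_divide_distrib)
      qed
      from this[of q] obtain f where "energy d \<Sigma> A n f \<ge> real q * (c * real n ^ d)" by auto
      moreover have "real q * (c * real n ^ d) > real n ^ d"
        using mult_strict_right_mono[OF q, of "real n ^ d"] n by (simp add: mult.assoc)
      ultimately show False using energy_le[OF assms(2), of d A n f] by simp
    qed
  qed
qed

end
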